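(* Let $({\bf v}_n)_{n\ge 0}$ be the sequence generated by the ideal iterative rule (defined in the context) from ${\bf v}_0\in\mathbb{R}^2$. Then there is at most one index $n\ge 0$ with ${\bf v}_n\in\mathcal{Z}_{12}$ (the system can have at most one multiple impact), and such an index exists if and only if ${\bf v}_0\in\mathcal{Z}_{12}$.
   Context: A rigid disk is simultaneously in contact with two walls forming a corner of angle $2\alpha\in(0,\pi)$; put $k=\tan\alpha>0$. The linear velocity of the disk is a pair $(\dot x,\dot y)\in\mathbb{R}^2$. The plane of velocities is partitioned into four zones: $\mathcal{Z}_0=\{k\dot x+\dot y\le 0,\ k\dot x-\dot y\le 0\}$ (exit velocities), $\mathcal{Z}_1=\{k\dot x+\dot y\le 0,\ k\dot x-\dot y>0\}$ (impact with the first wall only), $\mathcal{Z}_2=\{k\dot x+\dot y>0,\ k\dot x-\dot y\le 0\}$ (impact with the second wall only), $\mathcal{Z}_{12}=\{k\dot x+\dot y>0,\ k\dot x-\dot y>0\}$ (multiple impact). Ideal iterative rule. Given ${\bf v}_n=(\dot x_n,\dot y_n)$, define ${\bf v}_{n+1}=(\dot x_{n+1},\dot y_{n+1})$ by: - if ${\bf v}_n\in\mathcal{Z}_0$: ${\bf v}_{n+1}={\bf v}_n$; - if ${\bf v}_n\in\mathcal{Z}_1$: $\dot x_{n+1}=\frac{1-k^2}{1+k^2}\dot x_n+\frac{2k}{1+k^2}\dot y_n$, $\ \dot y_{n+1}=\frac{2k}{1+k^2}\dot x_n-\frac{1-k^2}{1+k^2}\dot y_n$; - if ${\bf v}_n\in\mathcal{Z}_2$: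 $\dot x_{n+1}=\frac{1-k^2}{1+k^2}\dot x_n-\frac{2k}{1+k^2}\dot y_n$, $\ \dot y_{n+1}=-\frac{2k}{1+k^2}\dot x_n-\frac{1-k^2}{1+k^2}\dot y_n$; - if ${\bf v}_n\in\mathcal{Z}_{12}$: $\dot x_{n+1}=\frac{-k^4\dot x_n^2+(1-2k^2)\dot y_n^2}{k^4\dot x_n^2+\dot y_n^2}\,\dot x_n$, $\ \dot y_{n+1}=\frac{k^2(k^2-2)\dot x_n^2-\dot y_n^2}{k^4\dot x_n^2+\dot y_n^2}\,\dot y_n$. *)

theory Defs
  imports Complex_Main
begin

definition Z0 :: "real \<Rightarrow> (real \<times> real) set" where
  "Z0 k = {(x, y). k * x + y \<le> 0 \<and> k * x - y \<le> 0}"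

definition Z1 :: "real \<Rightarrow> (real \<times> real) set" where
  "Z1 k = {(x, y). k * x + y \<le> 0 \<and> k * x - y > 0}"

definition Z2 :: "real \<Rightarrow> (real \<times> real) set" where
  "Z2 k = {(x, y). k * x + y > 0 \<and> k * x - y \<le> 0}"

definition Z12 :: "real \<Rightarrow> (real \<times> real) set" where
  "Z12 k = {(x, y). k * x + y > 0 \<and> k * x - y > 0}"

text \<open>The final branch is the multiple-impact zone, since the four zones partition the
  plane (see \<open>zones_cover\<close> and \<open>zones_disjoint\<close>).\<close>

fun ideal_step :: "real \<Rightarrow> real \<times> real \<Rightarrow> real \<times> real" where
  "ideal_step k (x, y) =
     (if (x, y) \<in> Z0 k then (x, y)
      else if (x, y) \<in> Z1 k then
        ((1 - k^2) / (1 + k^2) * x + 2 * k / (1 + k^2) * y,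
         2 * k / (1 + k^2) * x - (1 - k^2) / (1 + k^2) * y)
      else if (x, y) \<in> Z2 k then
        ((1 - k^2) / (1 + k^2) * x - 2 * k / (1 + k^2) * y,
         - (2 * k / (1 + k^2)) * x - (1 - k^2) / (1 + k^2) * y)
      else
        ((- (k^4) * x^2 + (1 - 2 * k^2) * y^2) / (k^4 * x^2 + y^2) * x,
         (k^2 * (k^2 - 2) * x^2 - y^2) / (k^4 * x^2 + y^2) * y))"

lemma zones_cover: "Z0 k \<union> Z1 k \<union> Z2 k \<union> Z12 k = UNIV"
  by (auto simp: Z0_def Z1_def Z2_def Z12_def)

lemma zones_disjoint:
  "Z0 k \<inter> Z1 k = {}" "Z0 k \<inter> Z2 k = {}" "Z0 k \<inter> Z12 k = {}"
  "Z1 k \<inter> Z2 k = {}" "Z1 k \<inter> Z12 k = {}" "Z2 k \<inter> Z12 k = {}"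
  by (auto simp: Z0_def Z1_def Z2_def Z12_def)

end

theory Submission
  imports Defs
begin

text \<open>
  A single step of the rule never ends in the multiple-impact zone, so among all indices only
  the initial one can lie there; both claims follow at once.

  Write \<open>u = k x\<close>; the multiple-impact zone is \<open>\<bar>y\<bar> < u\<close>, the conjunction of the two conditions
  \<open>u + y > 0\<close> and \<open>u - y > 0\<close> that the disk approaches the second and the first wall.
  It suffices that every step from outside the exit zone makes one of them fail. A simple impact
  is the reflection in the wall that is hit, so it reverses the sign of the corresponding linear
  form. A multiple impact turns the form of the wall approached faster (\<open>u + y\<close> if \<open>y \<ge> 0\<close>, and
  \<open>u - y\<close> if \<open>y \<le> 0\<close>) into a cubic in \<open>u\<close> and \<open>y\<close> over a nonnegative denominator, and for
  \<open>y \<ge> 0\<close> that cubic is nonpositive because \<open>u\<^sup>2 - u y + 2 y\<^sup>2\<close> and \<open>y\<^sup>2 - u y + 2 u\<^sup>2\<close> are positive semidefinite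
  (lemma \<open>multiple_impact_exits\<close>). The case \<open>y \<le> 0\<close> reduces to \<open>y \<ge> 0\<close> by the symmetry
  exchanging the walls.
\<close>

text \<open>With \<open>u = k x\<close> the numerator is
  \<open>- (k\<^sup>2 u (u\<^sup>2 - u y + 2 y\<^sup>2) + y (y\<^sup>2 - u y + 2 u\<^sup>2))\<close>, and both quadratic factors have
  discriminant \<open>1 - 8 < 0\<close>.\<close>

lemma multiple_impact_exits:
  fixes k x y :: real
  assumes "0 \<le> k * x" and "0 \<le> y"
  shows "k * ((- (k^4) * x^2 + (1 - 2 * k^2) * y^2) / (k^4 * x^2 + y^2) * x)
       + (k^2 * (k^2 - 2) * x^2 - y^2) / (k^4 * x^2 + y^2) * y \<le> 0"
proof -
  define u where "u = k * x"
  have "0 \<le> (u - y)^2 + u * y + y^2" "0 \<le> (u - y)^2 + u * y + u^2"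
    using assms by (simp_all add: u_def)
  then have quad: "0 \<le> u^2 - u * y + 2 * y^2" "0 \<le> y^2 - u * y + 2 * u^2"
    by (simp_all add: power2_eq_square algebra_simps)
  have "k * ((- (k^4) * x^2 + (1 - 2 * k^2) * y^2) / (k^4 * x^2 + y^2) * x)
       + (k^2 * (k^2 - 2) * x^2 - y^2) / (k^4 * x^2 + y^2) * y
     = (k * x * (- (k^4) * x^2 + (1 - 2 * k^2) * y^2)
       + y * (k^2 * (k^2 - 2) * x^2 - y^2)) / (k^4 * x^2 + y^2)"
    by (simp add: add_divide_distrib mult_ac)
  also have "k * x * (- (k^4) * x^2 + (1 - 2 * k^2) * y^2) + y * (k^2 * (k^2 - 2) * x^2 - y^2)
     = - (k^2 * u * (u^2 - u * y + 2 * y^2) + y * (y^2 - u * y + 2 * u^2))"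
    unfolding u_def by algebra
  also have "\<dots> / (k^4 * x^2 + y^2) \<le> 0"
  proof (rule divide_nonpos_nonneg)
    have "0 \<le> k^2 * u * (u^2 - u * y + 2 * y^2)" "0 \<le> y * (y^2 - u * y + 2 * u^2)"
      using assms quad by (auto simp: u_def intro!: mult_nonneg_nonneg)
    then show "- (k^2 * u * (u^2 - u * y + 2 * y^2) + y * (y^2 - u * y + 2 * u^2)) \<le> 0"
      by linarith
  qed simp
  finally show ?thesis .
qed

lemma ideal_step_notin_Z12: "ideal_step k p \<notin> Z12 k"
proof (cases p)
  case (Pair x y)
  have nz: "1 + k^2 \<noteq> 0"
    by (smt (verit) zero_le_power2)
  consider "p \<in> Z0 k" | "p \<in> Z1 k" | "p \<in> Z2 k" | "p \<in> Z12 k"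
    using zones_cover by blast
  then show ?thesis
  proof cases
    case 1
    then show ?thesis
      using Pair zones_disjoint(3)[of k] by auto
  next
    case 2
    have "k * ((1 - k^2) / (1 + k^2) * x + 2 * k / (1 + k^2) * y)
        - (2 * k / (1 + k^2) * x - (1 - k^2) / (1 + k^2) * y) = - (k * x - y)"
      using nz by (simp add: divide_simps) algebra
    moreover have "p \<notin> Z0 k" "k * x - y > 0"
      using 2 Pair by (auto simp: Z0_def Z1_def)
    ultimately show ?thesis
      using 2 Pair by (auto simp: Z12_def)
  next
    case 3
    have "k * ((1 - k^2) / (1 + k^2) * x - 2 * k / (1 + k^2) * y)
        + (- (2 * k / (1 + k^2)) * x - (1 - k^2) / (1 + k^2) * y) = - (k * x + y)"
      using nz by (simp add: divide_simps) algebra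
    moreover have "p \<notin> Z0 k" "p \<notin> Z1 k" "k * x + y > 0"
      using 3 Pair by (auto simp: Z0_def Z1_def Z2_def)
    ultimately show ?thesis
      using 3 Pair by (auto simp: Z12_def)
  next
    case 4
    then have notin: "p \<notin> Z0 k" "p \<notin> Z1 k" "p \<notin> Z2 k" and u: "0 \<le> k * x"
      using Pair by (auto simp: Z0_def Z1_def Z2_def Z12_def)
    show ?thesis
    proof (cases "0 \<le> y")
      case True
      show ?thesis
        using multiple_impact_exits[OF u True] notin Pair by (simp add: Z12_def)
    next
      case False
      then have "0 \<le> - y" by simp
      from multiple_impact_exits[OF u this] show ?thesis
        using notin Pair by (simp add: Z12_def)
    qed
  qed
qed

theorem mainTheorem5:
  fixes \<alpha> k :: real and v :: "nat \<Rightarrow> real \<times> real"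
  assumes "0 < 2 * \<alpha>" and "2 * \<alpha> < pi"
    and "k = tan \<alpha>"
    and "\<And>n. v (Suc n) = ideal_step k (v n)"
  shows "(\<exists>\<^sub>\<le>\<^sub>1 n. v n \<in> Z12 k) \<and> ((\<exists>n. v n \<in> Z12 k) \<longleftrightarrow> v 0 \<in> Z12 k)"
proof -
  have only_initial: "n = 0" if "v n \<in> Z12 k" for n
    using that assms(4) ideal_step_notin_Z12 by (cases n) auto
  then show ?thesis
    unfolding Uniq_def by metis
qed

end
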